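(* Let $V=\{v_1,\dots,v_m\}\subset\mathbb{R}^d$ be a finite set of $m$ points and let $r\in\mathrm{relint}(\mathrm{conv}(V))$. Let $k=\dim(\mathrm{aff}(V))$. Let $\mathcal{K}(V,r)=\{S\subset V\mid r\notin\mathrm{conv}(S)\}$ be the $r$-unbalanced simplicial complex on vertex set $V$, and let $\mathcal{K}^*(V,r)=\{\sigma\subset V\mid V\setminus\sigma\notin\mathcal{K}(V,r)\}$ be its Alexander dual. Then \[ \mathcal{K}(V,r)\simeq S^{k-1}\quad\text{and}\quad\mathcal{K}^*(V,r)\simeq S^{m-k-2}. \]
   Context: $\mathrm{aff}(V)$ is the affine hull of $V$ and $\mathrm{relint}$ denotes relative interior. $\simeq$ denotes homotopy equivalence (of geometric realizations). *)

theory Defs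
  imports "HOL-Analysis.Analysis"
begin

text \<open>Geometric realization of an abstract simplicial complex K (a set of faces,
  each a subset of the finite vertex set V), as the union of the simplices
  conv(e_v : v in sigma), sigma in K, inside the product space of functions V -> real.\<close>
definition geom_realization :: "'v set \<Rightarrow> 'v set set \<Rightarrow> ('v \<Rightarrow> real) topology" where
  "geom_realization V K =
     subtopology (product_topology (\<lambda>_. euclideanreal) V)
       {x. x \<in> (PiE V (\<lambda>_. UNIV)) \<and> (\<forall>v\<in>V. 0 \<le> x v) \<and> (\<Sum>v\<in>V. x v) = 1 \<and>
           (\<exists>\<sigma>\<in>K. {v\<in>V. x v \<noteq> 0} \<subseteq> \<sigma>)}"

definition int_sphere :: "int \<Rightarrow> (nat \<Rightarrow> real) topology" where
  "int_sphere n = (if n < 0 then subtopology (powertop_real UNIV) {} else nsphere (nat n))"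

definition unbalanced_complex :: "'a::euclidean_space set \<Rightarrow> 'a \<Rightarrow> 'a set set" where
  "unbalanced_complex V r = {S. S \<subseteq> V \<and> r \<notin> convex hull S}"

definition alexander_dual :: "'v set \<Rightarrow> 'v set set \<Rightarrow> 'v set set" where
  "alexander_dual V K = {\<sigma>. \<sigma> \<subseteq> V \<and> V - \<sigma> \<notin> K}"

end

theory Submission
  imports Defs
begin

text \<open>
  Both homotopy equivalences are instances of a nerve argument carried out by hand. A point
  \<open>y \<noteq> 0\<close> of a vector space \<open>Y\<close> is sent to the simplex spanned by those \<open>v\<close> for which \<open>y\<close>
  lies in, or close to, a convex cone \<open>U v\<close>; in the other direction, \<open>x\<close> in the complex is
  sent to a combination of chosen points \<open>u \<sigma> \<in> (\<Inter>v\<in>\<sigma>. U v)\<close>.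

  For \<open>\<K>(V, r)\<close> the space \<open>Y\<close> is the span of \<open>V - r\<close> and \<open>U v\<close> is the open half-space
  \<open>{y. 0 < y \<bullet> (v - r)}\<close>. For the Alexander dual, write \<open>r\<close> as a convex combination with all
  coefficients \<open>c v\<close> positive; then \<open>Y\<close> is the space of affine dependences \<open>\<mu>\<close> of \<open>V\<close>, of
  dimension \<open>m - k - 1\<close>, and \<open>U v\<close> consists of the \<open>\<mu>\<close> for which \<open>\<mu> v / c v\<close> is maximal: moving
  from \<open>c\<close> in direction \<open>-\<mu>\<close>, the coefficient at \<open>v\<close> vanishes first, so the faces are the sets
  of facets of the polytope of convex representations of \<open>r\<close> with a common point.
\<close>

section \<open>Coordinate spaces over an index set and straight-line homotopies\<close>

abbreviation function_space :: "'b set \<Rightarrow> ('b \<Rightarrow> real) set \<Rightarrow> ('b \<Rightarrow> real) topology" where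
  "function_space I S \<equiv> subtopology (product_topology (\<lambda>_. euclideanreal) I) S"

lemma continuous_map_function_space:
  "continuous_map X (function_space I S) f \<longleftrightarrow>
     (\<forall>x\<in>topspace X. f x \<in> S \<and> f x \<in> extensional I) \<and>
     (\<forall>i\<in>I. continuous_map X euclideanreal (\<lambda>x. f x i))"
  by (auto simp: continuous_map_in_subtopology continuous_map_componentwise)

lemma continuous_map_function_space_coord:
  "i \<in> I \<Longrightarrow> continuous_map (function_space I S) euclideanreal (\<lambda>x. x i)"
  by (intro continuous_intros)

text \<open>The set \<open>S\<close> is not assumed convex: only the segments from
  \<open>f x\<close> to \<open>g x\<close> have to stay inside it. The homotopies of the nerve
  argument are all built from such segments.\<close>

lemma homotopic_straight_line:
  assumes f: "continuous_map X (function_space I S) f"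
    and g: "continuous_map X (function_space I S) g"
    and line: "\<And>x t. \<lbrakk>x \<in> topspace X; 0 \<le> t; t \<le> 1\<rbrakk> \<Longrightarrow>
      (\<lambda>i\<in>I. (1 - t) * f x i + t * g x i) \<in> S"
  shows "homotopic_with (\<lambda>_. True) X (function_space I S) f g"
proof -
  let ?h = "\<lambda>(t,x). \<lambda>i\<in>I. (1 - t) * f x i + t * g x i"
  let ?P = "prod_topology (top_of_set {0..1}) X"
  have ext: "f x \<in> extensional I" "g x \<in> extensional I" if "x \<in> topspace X" for x
    using f g that by (auto simp: continuous_map_function_space)
  have t: "continuous_map ?P euclideanreal fst"
    by (metis continuous_map_fst continuous_map_into_fulltopology)
  have s: "continuous_map ?P euclideanreal (\<lambda>p. k (snd p) i)"
    if "continuous_map X (function_space I S) k" "i \<in> I" for k i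
    using continuous_map_compose[OF continuous_map_snd, of X euclideanreal "\<lambda>x. k x i"] that
    by (auto simp: continuous_map_function_space o_def)
  have "continuous_map ?P (function_space I S) ?h"
    unfolding continuous_map_function_space
    by (auto simp: line case_prod_unfold intro!: continuous_intros t s f g)
  moreover have "?h (0, x) = f x" "?h (1, x) = g x" if "x \<in> topspace X" for x
    using ext[OF that] by (auto simp: extensional_restrict restrict_def extensional_def)
  ultimately show ?thesis
    by (subst homotopic_with) (auto intro!: exI[of _ ?h])
qed

section \<open>Punctured coordinate space and the sphere\<close>

abbreviation nonzero_functions :: "'b set \<Rightarrow> ('b \<Rightarrow> real) set" where
  "nonzero_functions I \<equiv> {y \<in> extensional I. \<exists>i\<in>I. y i \<noteq> 0}"

text \<open>Radial projection onto the unit sphere is the equivalence; the bijection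
  \<open>\<pi>\<close> merely renames the coordinates \<open>I\<close> to the indices
  \<open>{..n}\<close> used by \<open>nsphere n\<close>.\<close>

lemma nonzero_functions_homotopy_equivalent_sphere:
  assumes "finite (I :: 'b set)"
  shows "function_space I (nonzero_functions I) homotopy_equivalent_space
           int_sphere (int (card I) - 1)"
proof (cases "I = {}")
  case True
  \<comment> \<open>Without coordinates there is no nonzero vector, and
    \<open>int_sphere (-1)\<close> is empty as well. This case occurs when \<open>V\<close> is a
    single point and, for the dual, when \<open>V\<close> is affinely independent.\<close>
  let ?X = "function_space I (nonzero_functions I)" and ?Y = "int_sphere (int (card I) - 1)"
  have "?X = trivial_topology" "?Y = trivial_topology"
    using True by (auto simp: int_sphere_def simp flip: null_topspace_iff_trivial)
  then show ?thesis
    by (simp add: homotopy_equivalent_space_def homotopic_on_empty)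
next
  case False
  \<comment> \<open>\<open>nsphere n\<close> sits in \<open>n + 1\<close> coordinates, so the
    dimension is one less than \<open>card I\<close>.\<close>
  define n where "n = card I - 1"
  have card: "card I = Suc n"
    using False assms by (simp add: n_def card_gt_0_iff)
  obtain \<pi> where \<pi>: "bij_betw \<pi> {..n} I"
    using assms card by (metis bij_betw_iff_card card_atMost finite_atMost)
  define \<rho> where "\<rho> = inv_into {..n} \<pi>"
  have \<rho>: "\<rho> i \<le> n" "\<pi> (\<rho> i) = i" if "i \<in> I" for i
    using \<pi> that unfolding \<rho>_def
    by (metis atMost_iff bij_betw_def inv_into_into, metis bij_betw_inv_into_right)
  have \<pi>I: "\<pi> k \<in> I" "\<rho> (\<pi> k) = k" if "k \<le> n" for k
    using \<pi> that unfolding \<rho>_def by (auto simp: bij_betw_apply bij_betw_inv_into_left)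
  let ?S = "{x. (\<Sum>i\<le>n. x i ^ 2) = 1 \<and> (\<forall>i>n. x i = (0::real))}"
  have sphere: "int_sphere (int (card I) - 1) = function_space UNIV ?S"
    by (simp add: card int_sphere_def nsphere)
  define N where "N y = sqrt (\<Sum>i\<in>I. y i ^ 2)" for y :: "'b \<Rightarrow> real"
  have N_pos: "N y > 0" if "y \<in> nonzero_functions I" for y
  proof -
    from that obtain i where "i \<in> I" "y i \<noteq> 0" by auto
    then have "0 < (\<Sum>i\<in>I. y i ^ 2)"
      using assms by (intro sum_pos2[of I i]) auto
    then show ?thesis by (simp add: N_def)
  qed
  define p where "p y k = (if k \<le> n then y (\<pi> k) / N y else 0)" for y k
  define q where "q x = (\<lambda>i\<in>I. x (\<rho> i))" for x :: "nat \<Rightarrow> real"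
  let ?Y = "function_space I (nonzero_functions I)" and ?T = "function_space UNIV ?S"
  have reindex: "(\<Sum>k\<le>n. h (\<pi> k)) = sum h I" for h :: "'b \<Rightarrow> real"
    using sum.reindex_bij_betw[OF \<pi>] .
  have N_q: "N (q x) = 1" if "x \<in> ?S" for x
  proof -
    have "(\<Sum>i\<in>I. (q x i)\<^sup>2) = (\<Sum>k\<le>n. (x k)\<^sup>2)"
      by (subst reindex[symmetric]) (auto simp: q_def \<pi>I intro!: sum.cong)
    then show ?thesis using that by (simp add: N_def)
  qed
  have cp: "continuous_map ?Y ?T p"
    unfolding continuous_map_function_space
  proof (intro conjI ballI)
    fix y assume "y \<in> topspace ?Y"
    then have "N y > 0" using N_pos by auto
    then have "(\<Sum>i\<in>I. (y i / N y)\<^sup>2) = 1"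
      unfolding power_divide sum_divide_distrib[symmetric] by (simp add: N_def sum_nonneg)
    then show "p y \<in> ?S"
      using reindex[of "\<lambda>i. (y i / N y)\<^sup>2"] by (simp add: p_def)
  next
    fix k
    show "continuous_map ?Y euclideanreal (\<lambda>y. p y k)"
    proof (cases "k \<le> n")
      case True
      have "continuous_map ?Y euclideanreal (\<lambda>y. y (\<pi> k))"
        using \<pi>I(1)[OF True] by (rule continuous_map_function_space_coord)
      moreover have "continuous_map ?Y euclideanreal N"
        unfolding N_def using assms
        by (intro continuous_intros continuous_map_function_space_coord) auto
      moreover have "N y \<noteq> 0" if "y \<in> topspace ?Y" for y
        using N_pos[of y] that by simp
      ultimately have "continuous_map ?Y euclideanreal (\<lambda>y. y (\<pi> k) / N y)"
        by (rule continuous_map_real_divide)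
      then show ?thesis
        by (simp add: p_def True)
    qed (simp add: p_def)
  qed simp
  have cq: "continuous_map ?T ?Y q"
    unfolding continuous_map_function_space
  proof (intro conjI ballI)
    fix x assume "x \<in> topspace ?T"
    then have "x \<in> ?S" by simp
    then have "N (q x) = 1" by (rule N_q)
    then have "\<exists>i\<in>I. q x i \<noteq> 0"
      by (rule contrapos_pp) (simp add: N_def)
    then show "q x \<in> nonzero_functions I" by (simp add: q_def)
  next
    fix i assume "i \<in> I"
    then show "continuous_map ?T euclideanreal (\<lambda>x. q x i)"
      by (simp add: q_def continuous_map_function_space_coord)
  qed (simp add: q_def)
  have pq: "homotopic_with (\<lambda>_. True) ?T ?T (p \<circ> q) id"
  proof (rule homotopic_with_equal)
    show "continuous_map ?T ?T (p \<circ> q)"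
      using continuous_map_compose[OF cq cp] .
    fix x assume "x \<in> topspace ?T"
    then have x: "x \<in> ?S" by simp
    show "(p \<circ> q) x = id x"
    proof
      fix k show "(p \<circ> q) x k = id x k"
        using x N_q[OF x] by (cases "k \<le> n") (auto simp: p_def q_def \<pi>I)
    qed
  qed auto
  have qp: "homotopic_with (\<lambda>_. True) ?Y ?Y (q \<circ> p) id"
  proof (rule homotopic_straight_line)
    show "continuous_map ?Y ?Y (q \<circ> p)"
      using continuous_map_compose[OF cp cq] .
    fix y t assume "y \<in> topspace ?Y" and t: "0 \<le> t" "t \<le> (1::real)"
    then have y: "y \<in> nonzero_functions I" by simp
    then obtain i where i: "i \<in> I" "y i \<noteq> 0" by auto
    \<comment> \<open>\<open>q (p y)\<close> is \<open>y\<close> divided by its norm, so each point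
      of the segment is a positive multiple of \<open>y\<close> and avoids zero.\<close>
    have "(1 - t) / N y + t > 0"
      using N_pos[OF y] t by (cases "t = 0") (auto intro!: add_nonneg_pos)
    moreover have "(1 - t) * (q \<circ> p) y i + t * id y i = ((1 - t) / N y + t) * y i"
      using i by (simp add: q_def p_def \<rho> algebra_simps)
    ultimately show "(\<lambda>i\<in>I. (1 - t) * (q \<circ> p) y i + t * id y i) \<in> nonzero_functions I"
      using i by (auto intro!: bexI[of _ i])
  qed simp
  show ?thesis
    unfolding sphere homotopy_equivalent_space_def using cp cq pq qp by blast
qed

section \<open>Maps and homotopies into geometric realizations\<close>

lemma geom_realization_function_space:
  "geom_realization V K = function_space V
     {x \<in> extensional V. (\<forall>v\<in>V. 0 \<le> x v) \<and> (\<Sum>v\<in>V. x v) = 1 \<and>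
         (\<exists>\<sigma>\<in>K. {v\<in>V. x v \<noteq> 0} \<subseteq> \<sigma>)}"
  unfolding geom_realization_def PiE_UNIV_domain PiE_def by simp

lemma in_topspace_geom_realization:
  "x \<in> topspace (geom_realization V K) \<longleftrightarrow>
     x \<in> extensional V \<and> (\<forall>v\<in>V. 0 \<le> x v) \<and> (\<Sum>v\<in>V. x v) = 1 \<and>
     (\<exists>\<sigma>\<in>K. {v\<in>V. x v \<noteq> 0} \<subseteq> \<sigma>)"
  by (auto simp: geom_realization_function_space PiE_UNIV_domain extensional_def)

text \<open>Turns weights into barycentric coordinates, as a partition of unity does. The maps
  \<open>f\<close> and \<open>h\<close> of the nerve argument arise in this way.\<close>

lemma continuous_map_normalize_to_geom_realization:
  assumes "finite V"
    and cont: "\<And>v. v \<in> V \<Longrightarrow> continuous_map X euclideanreal (\<lambda>x. w x v)"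
    and nonneg: "\<And>x v. \<lbrakk>x \<in> topspace X; v \<in> V\<rbrakk> \<Longrightarrow> 0 \<le> w x v"
    and pos: "\<And>x. x \<in> topspace X \<Longrightarrow> \<exists>v\<in>V. 0 < w x v"
    and face: "\<And>x. x \<in> topspace X \<Longrightarrow> \<exists>\<sigma>\<in>K. {v \<in> V. 0 < w x v} \<subseteq> \<sigma>"
  shows "continuous_map X (geom_realization V K) (\<lambda>x. \<lambda>v\<in>V. w x v / sum (w x) V)"
proof -
  have sum_pos: "sum (w x) V > 0" if x: "x \<in> topspace X" for x
    using pos[OF x] nonneg[OF x] \<open>finite V\<close> by (metis sum_pos2)
  have "sum (\<lambda>v. w x v / sum (w x) V) V = 1" if x: "x \<in> topspace X" for x
    using sum_pos[OF x] by (simp flip: sum_divide_distrib)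
  moreover have "\<exists>\<sigma>\<in>K. {v \<in> V. w x v / sum (w x) V \<noteq> 0} \<subseteq> \<sigma>" if x: "x \<in> topspace X" for x
    using face[OF x] nonneg[OF x] sum_pos[OF x]
    by (smt (verit) Collect_mono divide_eq_0_iff subset_trans)
  ultimately show ?thesis
    unfolding geom_realization_function_space continuous_map_function_space
    using \<open>finite V\<close> sum_pos nonneg
    by (auto intro!: continuous_intros cont divide_nonneg_pos
        dest: less_imp_neq[OF sum_pos] cong: conj_cong)
qed

text \<open>A form of contiguity: along the segment the support never leaves that of
  \<open>q x\<close>, hence stays in one face.\<close>

lemma homotopic_in_geom_realization:
  assumes "finite V"
    and p: "continuous_map X (geom_realization V K) p"
    and q: "continuous_map X (geom_realization V K) q"
    and supp: "\<And>x v. \<lbrakk>x \<in> topspace X; v \<in> V; p x v \<noteq> 0\<rbrakk> \<Longrightarrow> q x v \<noteq> 0"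
  shows "homotopic_with (\<lambda>_. True) X (geom_realization V K) p q"
  unfolding geom_realization_function_space
proof (rule homotopic_straight_line)
  fix x and t :: real assume x: "x \<in> topspace X" and t: "0 \<le> t" "t \<le> 1"
  have "p x \<in> topspace (geom_realization V K)" "q x \<in> topspace (geom_realization V K)"
    using p q x by (auto simp: continuous_map_def)
  then have px: "\<forall>v\<in>V. 0 \<le> p x v" "(\<Sum>v\<in>V. p x v) = 1"
    and qx: "\<forall>v\<in>V. 0 \<le> q x v" "(\<Sum>v\<in>V. q x v) = 1" "\<exists>\<sigma>\<in>K. {v\<in>V. q x v \<noteq> 0} \<subseteq> \<sigma>"
    by (auto simp: in_topspace_geom_realization)
  have "(\<Sum>v\<in>V. (1 - t) * p x v + t * q x v) = 1"
    using px qx by (simp add: sum.distrib flip: sum_distrib_left)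
  moreover have "{v\<in>V. (1 - t) * p x v + t * q x v \<noteq> 0} \<subseteq> {v\<in>V. q x v \<noteq> 0}"
    using supp[OF x] by force
  ultimately show "(\<lambda>v\<in>V. (1 - t) * p x v + t * q x v) \<in> {x \<in> extensional V.
     (\<forall>v\<in>V. 0 \<le> x v) \<and> (\<Sum>v\<in>V. x v) = 1 \<and> (\<exists>\<sigma>\<in>K. {v\<in>V. x v \<noteq> 0} \<subseteq> \<sigma>)}"
    using px qx t by (auto cong: conj_cong) (metis (no_types, lifting) order_trans)
qed (use p q in \<open>simp_all add: geom_realization_function_space\<close>)

section \<open>The nerve argument for convex cones\<close>

text \<open>Induction from binary combinations. Terms with coefficient zero are dropped first, since
  their \<open>u s\<close> may lie outside \<open>U\<close>; some coefficient must be positive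
  because \<open>U\<close> may omit zero.\<close>

lemma cone_combination:
  fixes U :: "('b \<Rightarrow> real) set"
  assumes cone: "\<And>y z a b. \<lbrakk>y \<in> U; z \<in> U; 0 \<le> a; 0 \<le> b; 0 < a + b\<rbrakk> \<Longrightarrow>
      (\<lambda>i\<in>I. a * y i + b * z i) \<in> U"
    and "finite S" "\<And>s. s \<in> S \<Longrightarrow> 0 \<le> a s" "\<exists>s\<in>S. 0 < a s"
    and "\<And>s. \<lbrakk>s \<in> S; 0 < a s\<rbrakk> \<Longrightarrow> u s \<in> U"
  shows "(\<lambda>i\<in>I. \<Sum>s\<in>S. a s * u s i) \<in> U"
  using assms(2-)
proof (induction S rule: finite_induct)
  case (insert s S)
  show ?case
  proof (cases "\<exists>s\<in>S. 0 < a s")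
    case True
    then have IH: "(\<lambda>i\<in>I. \<Sum>s\<in>S. a s * u s i) \<in> U"
      using insert by blast
    show ?thesis
    proof (cases "a s = 0")
      case True
      then show ?thesis using IH insert.hyps by (simp add: restrict_def)
    next
      case False
      then have "0 < a s" using insert.prems(1)[of s] by simp
      then show ?thesis
        using cone[OF insert.prems(3)[of s] IH, of "a s" 1] insert.hyps
        by (simp add: restrict_def cong: if_cong)
    qed
  next
    case False
    then have "\<forall>s\<in>S. a s = 0" using insert.prems(1) by (metis insertCI order_less_le)
    moreover have "0 < a s" using False insert.prems(2) by auto
    ultimately show ?thesis
      using cone[OF insert.prems(3)[of s] insert.prems(3)[of s], of "a s" 0] insert.hyps
      by (simp add: restrict_def)
  qed
qed simp

text \<open>The cones need not be open, which the dual complex requires. As \<open>f y\<close> lies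
  in the complex, \<open>f_pos\<close> encodes that vertices whose cones share a point span a face;
  \<open>f_max\<close> ensures that \<open>y\<close> and \<open>g (f y)\<close> share a
  cone.\<close>

theorem nerve_homotopy_equivalence:
  fixes V :: "'v set" and I :: "'b set" and U :: "'v \<Rightarrow> ('b \<Rightarrow> real) set"
  assumes "finite V" and K: "K \<subseteq> Pow V"
    and U_sub: "\<And>v. v \<in> V \<Longrightarrow> U v \<subseteq> Y"
    and Y_ext: "Y \<subseteq> extensional I"
    and cone: "\<And>v y z a b. \<lbrakk>v \<in> V; y \<in> U v; z \<in> U v; 0 \<le> a; 0 \<le> b; 0 < a + b\<rbrakk> \<Longrightarrow>
      (\<lambda>i\<in>I. a * y i + b * z i) \<in> U v"
    and meet: "\<And>\<sigma>. \<sigma> \<in> K \<Longrightarrow> \<exists>y. \<forall>v\<in>\<sigma>. y \<in> U v"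
    and sub: "\<And>\<sigma> \<tau>. \<lbrakk>\<sigma> \<in> K; \<tau> \<subseteq> \<sigma>\<rbrakk> \<Longrightarrow> \<tau> \<in> K"
    and f: "continuous_map (function_space I Y) (geom_realization V K) f"
    and f_pos: "\<And>v y. \<lbrakk>v \<in> V; y \<in> U v\<rbrakk> \<Longrightarrow> 0 < f y v"
    and f_max: "\<And>v y. \<lbrakk>v \<in> V; y \<in> Y; \<forall>w\<in>V. f y w \<le> f y v\<rbrakk> \<Longrightarrow> y \<in> U v"
  shows "function_space I Y homotopy_equivalent_space geom_realization V K"
proof -
  let ?Y = "function_space I Y" and ?K = "geom_realization V K"
  \<comment> \<open>Below \<open>1 / card V\<close>, which some barycentric coordinate always reaches.\<close>
  define c where "c = 1 / (2 * real (card V))"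
  have c_less: "c < x v" and c_pos: "0 < c" if "x \<in> topspace ?K" "v \<in> V" "\<forall>w\<in>V. x w \<le> x v" for x v
  proof -
    have pos: "real (card V) > 0" using \<open>finite V\<close> \<open>v \<in> V\<close> by (auto simp: card_gt_0_iff)
    have "1 \<le> real (card V) * x v"
      using sum_bounded_above[of V x "x v"] that by (simp add: in_topspace_geom_realization)
    then show "c < x v" using pos by (simp add: c_def field_simps)
    show "0 < c" using pos by (simp add: c_def)
  qed
  have max_ex: "\<exists>v\<in>V. \<forall>w\<in>V. x w \<le> x v" if "x \<in> topspace ?K" for x
  proof -
    have "V \<noteq> {}" using that by (auto simp: in_topspace_geom_realization)
    then have "Max (x ` V) \<in> x ` V" using \<open>finite V\<close> by simp
    then obtain v where "v \<in> V" "x v = Max (x ` V)" by auto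
    then show ?thesis using \<open>finite V\<close> by (metis Max_ge finite_imageI imageI)
  qed
  have big: "\<exists>v\<in>V. c < x v" and c0: "0 < c" if "x \<in> topspace ?K" for x
    using max_ex[OF that] c_less[OF that] c_pos[OF that] by blast+
  define u where "u \<sigma> = (SOME y. \<forall>v\<in>\<sigma>. y \<in> U v)" for \<sigma>
  have u: "u \<sigma> \<in> U v" if "\<sigma> \<in> K" "v \<in> \<sigma>" for \<sigma> v
    using someI_ex[OF meet[of \<sigma>]] that unfolding u_def by blast
  \<comment> \<open>\<open>\<mu> x \<sigma> > 0\<close> forces \<open>{v. c \<le> x v} \<subseteq> \<sigma> \<subseteq> supp x\<close>, so \<open>g x \<in> U v\<close> whenever \<open>c \<le> x v\<close>.
    Without a threshold no continuous choice exists, since the support of \<open>x\<close> is only lower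
    semicontinuous. The map \<open>h\<close>, supported on \<open>{v. c < x v}\<close>, then links \<open>f \<circ> g\<close> to the identity.\<close>
  define \<mu> where "\<mu> x \<sigma> = (\<Prod>v\<in>\<sigma>. x v) * (\<Prod>v\<in>V - \<sigma>. max 0 (c - x v))" for x :: "'v \<Rightarrow> real" and \<sigma>
  define g where "g x = (\<lambda>i\<in>I. \<Sum>\<sigma>\<in>K. \<mu> x \<sigma> * u \<sigma> i)" for x
  define h where "h x = (\<lambda>v\<in>V. max 0 (x v - c) / (\<Sum>w\<in>V. max 0 (x w - c)))" for x
  have finK: "finite K" and fin: "\<And>\<sigma>. \<sigma> \<in> K \<Longrightarrow> finite \<sigma>"
    using K \<open>finite V\<close> by (auto intro: finite_subset)
  have g_U: "g x \<in> U v" if x: "x \<in> topspace ?K" and v: "v \<in> V" "c \<le> x v" for x v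
    unfolding g_def
  proof (rule cone_combination)
    have x': "\<And>v. v \<in> V \<Longrightarrow> 0 \<le> x v"
      using x by (simp add: in_topspace_geom_realization)
    show "0 \<le> \<mu> x \<sigma>" if "\<sigma> \<in> K" for \<sigma>
    proof -
      have "\<sigma> \<subseteq> V" using K that by auto
      then show ?thesis
        unfolding \<mu>_def using x' by (intro mult_nonneg_nonneg prod_nonneg) auto
    qed
    let ?S = "{v \<in> V. x v \<noteq> 0}"
    \<comment> \<open>The support of \<open>x\<close> is a face by \<open>sub\<close>; there the
      first product is positive, and every factor of the second equals \<open>c\<close>.\<close>
    have "?S \<in> K" using x sub by (auto simp: in_topspace_geom_realization)
    moreover have "0 < \<mu> x ?S"
    proof -
      have "0 < x v" if "v \<in> ?S" for v
        using that x'[of v] by (simp add: order_less_le)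
      then show ?thesis
        unfolding \<mu>_def using c0[OF x] by (intro mult_pos_pos prod_pos) auto
    qed
    ultimately show "\<exists>\<sigma>\<in>K. 0 < \<mu> x \<sigma>" by blast
    fix \<sigma> assume \<sigma>: "\<sigma> \<in> K" and pos: "0 < \<mu> x \<sigma>"
    \<comment> \<open>Otherwise the factor at \<open>v\<close> in the second product vanishes,
      because \<open>c \<le> x v\<close>.\<close>
    have "v \<in> \<sigma>"
    proof (rule ccontr)
      assume "v \<notin> \<sigma>"
      then have "(\<Prod>v\<in>V - \<sigma>. max 0 (c - x v)) = 0"
        using v \<open>finite V\<close> by (intro prod_zero bexI[of _ v]) auto
      then show False using pos by (simp add: \<mu>_def)
    qed
    then show "u \<sigma> \<in> U v" using u \<sigma> by blast
  qed (fact cone[OF v(1)], fact finK)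
  have g: "continuous_map ?K ?Y g"
    unfolding continuous_map_function_space
  proof (intro conjI ballI)
    fix x assume x: "x \<in> topspace ?K"
    show "g x \<in> Y" using big[OF x] g_U[OF x] U_sub by (metis less_imp_le subsetD)
    show "g x \<in> extensional I" by (simp add: g_def)
  next
    fix i assume "i \<in> I"
    have "continuous_map ?K euclideanreal (\<lambda>x. x v)" if "v \<in> V" for v
      unfolding geom_realization_function_space
      by (rule continuous_map_function_space_coord[OF that])
    then show "continuous_map ?K euclideanreal (\<lambda>x. g x i)"
      unfolding g_def \<mu>_def using \<open>i \<in> I\<close> K finK fin \<open>finite V\<close>
      by (auto intro!: continuous_intros)
  qed
  have h: "continuous_map ?K ?K h"
    unfolding h_def
  proof (rule continuous_map_normalize_to_geom_realization)
    fix v assume "v \<in> V"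
    have "continuous_map ?K euclideanreal (\<lambda>x. x v)"
      unfolding geom_realization_function_space
      by (rule continuous_map_function_space_coord[OF \<open>v \<in> V\<close>])
    then show "continuous_map ?K euclideanreal (\<lambda>x. max 0 (x v - c))"
      by (auto intro!: continuous_intros)
  next
    fix x assume x: "x \<in> topspace ?K"
    then obtain \<sigma> where \<sigma>: "\<sigma> \<in> K" "{v\<in>V. x v \<noteq> 0} \<subseteq> \<sigma>"
      by (auto simp: in_topspace_geom_realization)
    then show "\<exists>\<sigma>\<in>K. {v \<in> V. 0 < max 0 (x v - c)} \<subseteq> \<sigma>"
      using c0[OF x] by (intro bexI[of _ \<sigma>]) auto
    show "\<exists>v\<in>V. 0 < max 0 (x v - c)" using big[OF x] by (simp add: less_max_iff_disj)
  qed (use \<open>finite V\<close> in auto)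
  have h_supp: "c < x v" if "v \<in> V" "h x v \<noteq> 0" for x v
    using that by (auto simp: h_def max_def split: if_splits)
  have fg: "continuous_map ?K ?K (f \<circ> g)"
    using continuous_map_compose[OF g f] .
  have "homotopic_with (\<lambda>_. True) ?K ?K h id"
  proof (rule homotopic_in_geom_realization)
    fix x v assume "x \<in> topspace ?K" "v \<in> V" "h x v \<noteq> 0"
    then show "id x v \<noteq> 0" using h_supp c0 by fastforce
  qed (use \<open>finite V\<close> h in auto)
  moreover have "homotopic_with (\<lambda>_. True) ?K ?K h (f \<circ> g)"
  proof (rule homotopic_in_geom_realization)
    fix x v assume *: "x \<in> topspace ?K" "v \<in> V" "h x v \<noteq> 0"
    then have "g x \<in> U v" using g_U[OF *(1,2)] h_supp[OF *(2,3)] by simp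
    then show "(f \<circ> g) x v \<noteq> 0" using f_pos[OF *(2)] by fastforce
  qed (use \<open>finite V\<close> h fg in auto)
  ultimately have *: "homotopic_with (\<lambda>_. True) ?K ?K (f \<circ> g) id"
    by (meson homotopic_with_symD homotopic_with_trans)
  have **: "homotopic_with (\<lambda>_. True) ?Y ?Y (g \<circ> f) id"
  proof (rule homotopic_straight_line)
    show "continuous_map ?Y ?Y (g \<circ> f)"
      using continuous_map_compose[OF f g] .
    fix y and t :: real assume y: "y \<in> topspace ?Y" and t: "0 \<le> t" "t \<le> 1"
    have fy: "f y \<in> topspace ?K" using f y by (auto simp: continuous_map_def)
    \<comment> \<open>At a largest coordinate \<open>v\<close> of \<open>f y\<close>, both ends of
      the segment lie in the convex cone \<open>U v\<close>, which is contained in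
      \<open>Y\<close>.\<close>
    obtain v where v: "v \<in> V" "\<forall>w\<in>V. f y w \<le> f y v" using max_ex[OF fy] by blast
    have "g (f y) \<in> U v" using g_U[OF fy v(1)] c_less[OF fy v] by simp
    moreover have "y \<in> U v" using f_max[OF v(1) _ v(2)] y by simp
    ultimately have "(\<lambda>i\<in>I. (1 - t) * g (f y) i + t * y i) \<in> U v"
      using t by (intro cone[OF v(1)]) auto
    then show "(\<lambda>i\<in>I. (1 - t) * (g \<circ> f) y i + t * id y i) \<in> Y"
      using U_sub[OF v(1)] by auto
  qed simp
  show ?thesis
    unfolding homotopy_equivalent_space_def using f g * ** by blast
qed

section \<open>Linear forms and two instances of the nerve argument\<close>

definition lin_form :: "'b set \<Rightarrow> ('b \<Rightarrow> real) \<Rightarrow> ('b \<Rightarrow> real) \<Rightarrow> real" where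
  "lin_form I a y = (\<Sum>i\<in>I. a i * y i)"

lemma lin_form_combination:
  "lin_form I a (\<lambda>i. s * y i + t * z i) = s * lin_form I a y + t * lin_form I a z"
  by (simp add: lin_form_def sum_distrib_left algebra_simps sum.distrib)

lemma lin_form_restrict [simp]: "lin_form I a (restrict y I) = lin_form I a y"
  by (simp add: lin_form_def)

lemma lin_form_scale: "lin_form I a (\<lambda>i. c * y i) = c * lin_form I a y"
  by (simp add: lin_form_def sum_distrib_left mult.left_commute)

lemma lin_form_nonzero: "lin_form I a y \<noteq> 0 \<Longrightarrow> \<exists>i\<in>I. y i \<noteq> 0"
  unfolding lin_form_def by (rule ccontr) simp

lemma continuous_map_lin_form:
  "finite I \<Longrightarrow> continuous_map (function_space I S) euclideanreal (lin_form I a)"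
  unfolding lin_form_def
  by (intro continuous_intros continuous_map_function_space_coord) auto

lemma continuous_map_Max:
  fixes F :: "'c \<Rightarrow> 'a \<Rightarrow> real"
  assumes "finite V" "V \<noteq> {}" "\<And>v. v \<in> V \<Longrightarrow> continuous_map X euclideanreal (F v)"
  shows "continuous_map X euclideanreal (\<lambda>x. Max ((\<lambda>v. F v x) ` V))"
  using assms
proof (induction V rule: finite_ne_induct)
  case (insert v V)
  then show ?case by (auto intro!: continuous_map_real_max)
qed simp

text \<open>The positive parts of the forms serve as weights: the support at \<open>y\<close> is a
  face witnessed by \<open>y\<close> itself, and \<open>pos\<close> makes the weights
  normalizable.\<close>

theorem open_halfspace_nerve:
  fixes V :: "'v set" and I :: "'b set" and a :: "'v \<Rightarrow> 'b \<Rightarrow> real"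
  assumes "finite V" "finite I"
    and pos: "\<And>y. y \<in> nonzero_functions I \<Longrightarrow> \<exists>v\<in>V. 0 < lin_form I (a v) y"
  shows "function_space I (nonzero_functions I) homotopy_equivalent_space
    geom_realization V {S. S \<subseteq> V \<and> (\<exists>y. \<forall>v\<in>S. 0 < lin_form I (a v) y)}"
    (is "_ homotopy_equivalent_space geom_realization V ?K")
proof -
  let ?Y = "nonzero_functions I"
  define U where "U v = {y \<in> extensional I. 0 < lin_form I (a v) y}" for v
  define W where "W y v = max 0 (lin_form I (a v) y)" for y v
  have W_sum: "0 < sum (W y) V" if "y \<in> ?Y" for y
  proof -
    from pos[OF that] obtain v where "v \<in> V" "0 < W y v" by (auto simp: W_def less_max_iff_disj)
    then show ?thesis using \<open>finite V\<close> by (intro sum_pos2[of V v]) (auto simp: W_def)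
  qed
  show ?thesis
  proof (rule nerve_homotopy_equivalence)
    show "U v \<subseteq> ?Y" for v
      unfolding U_def using lin_form_nonzero[of I "a v"] by fastforce
    show "(\<lambda>i\<in>I. s * y i + t * z i) \<in> U v"
      if "y \<in> U v" "z \<in> U v" "0 \<le> s" "0 \<le> t" "0 < s + t" for v y z s t
    proof -
      have "0 < s * lin_form I (a v) y + t * lin_form I (a v) z"
        using that by (cases "s = 0") (auto simp: U_def add_pos_nonneg)
      then show ?thesis by (simp add: U_def lin_form_combination)
    qed
    show "\<exists>y. \<forall>v\<in>\<sigma>. y \<in> U v" if "\<sigma> \<in> ?K" for \<sigma>
    proof -
      from that obtain y where "\<forall>v\<in>\<sigma>. 0 < lin_form I (a v) y" by auto
      \<comment> \<open>The witness of a face is an arbitrary function; restricting it to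
        \<open>I\<close> makes it extensional and leaves the forms unchanged.\<close>
      then have "\<forall>v\<in>\<sigma>. restrict y I \<in> U v" by (simp add: U_def)
      then show ?thesis by blast
    qed
    show "continuous_map (function_space I ?Y) (geom_realization V ?K)
      (\<lambda>y. \<lambda>v\<in>V. W y v / sum (W y) V)"
    proof (rule continuous_map_normalize_to_geom_realization)
      show "continuous_map (function_space I ?Y) euclideanreal (\<lambda>y. W y v)" for v
        unfolding W_def
        by (intro continuous_intros continuous_map_lin_form assms continuous_map_const[THEN iffD2]) auto
      fix y assume "y \<in> topspace (function_space I ?Y)"
      then show "\<exists>v\<in>V. 0 < W y v"
        using pos[of y] by (auto simp: W_def less_max_iff_disj)
      have "{v \<in> V. 0 < W y v} \<in> ?K"
        by (auto simp: W_def less_max_iff_disj)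
      then show "\<exists>\<sigma>\<in>?K. {v \<in> V. 0 < W y v} \<subseteq> \<sigma>" by blast
    qed (use \<open>finite V\<close> in \<open>auto simp: W_def\<close>)
    show "0 < (\<lambda>v\<in>V. W y v / sum (W y) V) v" if "v \<in> V" "y \<in> U v" for v y
    proof -
      have "0 < W y v" using that by (simp add: W_def U_def)
      moreover have "0 < sum (W y) V"
        using \<open>0 < W y v\<close> that \<open>finite V\<close> by (intro sum_pos2[of V v]) (auto simp: W_def)
      ultimately show ?thesis using that by simp
    qed
    fix v y assume v: "v \<in> V" and y: "y \<in> ?Y"
      and max: "\<forall>w\<in>V. (\<lambda>v\<in>V. W y v / sum (W y) V) w \<le> (\<lambda>v\<in>V. W y v / sum (W y) V) v"
    from pos[OF y] obtain w where w: "w \<in> V" "0 < W y w" by (auto simp: W_def less_max_iff_disj)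
    have "W y w \<le> W y v"
      using max w(1) v W_sum[OF y] by (auto simp: divide_le_cancel)
    then have "0 < W y v" using w(2) by simp
    then show "y \<in> U v"
      using y by (simp add: U_def W_def less_max_iff_disj)
  qed (use \<open>finite V\<close> in auto)
qed

text \<open>\<open>U v\<close> is the cone over the face where the form at \<open>v\<close> equals 1
  in the polytope of all \<open>y\<close> whose forms are at most 1. These cones are too thin to
  support continuous weights, so they are thickened by \<open>\<epsilon>\<close>;
  \<open>near\<close> says that the thickening creates no new faces.\<close>

theorem facet_nerve:
  fixes V :: "'v set" and I :: "'b set" and a :: "'v \<Rightarrow> 'b \<Rightarrow> real"
  defines "K \<equiv> {\<sigma>. \<sigma> \<subseteq> V \<and> (\<exists>y. \<forall>v\<in>\<sigma>. 0 < lin_form I (a v) y \<and>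
      (\<forall>w\<in>V. lin_form I (a w) y \<le> lin_form I (a v) y))}"
  assumes "finite V" "finite I"
    and pos: "\<And>y. y \<in> nonzero_functions I \<Longrightarrow> \<exists>v\<in>V. 0 < lin_form I (a v) y"
    and "0 < \<epsilon>"
    and near: "\<And>y. \<forall>w\<in>V. lin_form I (a w) y \<le> 1 \<Longrightarrow>
      {v \<in> V. 1 - \<epsilon> < lin_form I (a v) y} \<in> K"
  shows "function_space I (nonzero_functions I) homotopy_equivalent_space geom_realization V K"
proof -
  let ?Y = "nonzero_functions I"
  define U where "U v = {y \<in> extensional I. 0 < lin_form I (a v) y \<and>
      (\<forall>w\<in>V. lin_form I (a w) y \<le> lin_form I (a v) y)}" for v
  define M where "M y = Max ((\<lambda>v. lin_form I (a v) y) ` V)" for y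
  define W where "W y v = max 0 (lin_form I (a v) y - (1 - \<epsilon>) * M y)" for y v
  have M_ge: "lin_form I (a v) y \<le> M y" if "v \<in> V" for v y
    using that \<open>finite V\<close> by (simp add: M_def)
  have M_pos: "0 < M y" if "y \<in> ?Y" for y
    using pos[OF that] M_ge by (meson less_le_trans)
  have W_M: "0 < W y v" if "lin_form I (a v) y = M y" "0 < M y" for y v
    using that \<open>0 < \<epsilon>\<close> by (simp add: W_def algebra_simps less_max_iff_disj)
  have W_ex: "\<exists>v\<in>V. lin_form I (a v) y = M y" if "y \<in> ?Y" for y
  proof -
    have "V \<noteq> {}" using pos[OF that] by auto
    then have "M y \<in> (\<lambda>v. lin_form I (a v) y) ` V"
      unfolding M_def using \<open>finite V\<close> by (intro Max_in) auto
    then show ?thesis by auto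
  qed
  have sum_W: "0 < sum (W y) V" if "v \<in> V" "0 < W y v" for y v
    using that \<open>finite V\<close> by (intro sum_pos2[of V v]) (auto simp: W_def)
  show ?thesis
  proof (rule nerve_homotopy_equivalence)
    show "U v \<subseteq> ?Y" for v
      unfolding U_def using lin_form_nonzero[of I "a v"] by fastforce
    show "(\<lambda>i\<in>I. s * y i + t * z i) \<in> U v"
      if "y \<in> U v" "z \<in> U v" "0 \<le> s" "0 \<le> t" "0 < s + t" for v y z s t
    proof -
      have "0 < s * lin_form I (a v) y + t * lin_form I (a v) z"
        using that by (cases "s = 0") (auto simp: U_def add_pos_nonneg)
      moreover have "s * lin_form I (a w) y + t * lin_form I (a w) z
          \<le> s * lin_form I (a v) y + t * lin_form I (a v) z" if "w \<in> V" for w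
        using that \<open>y \<in> U v\<close> \<open>z \<in> U v\<close> \<open>0 \<le> s\<close> \<open>0 \<le> t\<close>
        by (intro add_mono mult_left_mono) (auto simp: U_def)
      ultimately show ?thesis by (simp add: U_def lin_form_combination)
    qed
    show "\<exists>y. \<forall>v\<in>\<sigma>. y \<in> U v" if "\<sigma> \<in> K" for \<sigma>
    proof -
      from that obtain y where "\<forall>v\<in>\<sigma>. 0 < lin_form I (a v) y \<and>
          (\<forall>w\<in>V. lin_form I (a w) y \<le> lin_form I (a v) y)"
        by (auto simp: K_def)
      then have "\<forall>v\<in>\<sigma>. restrict y I \<in> U v" by (simp add: U_def)
      then show ?thesis by blast
    qed
    show "\<tau> \<in> K" if "\<sigma> \<in> K" "\<tau> \<subseteq> \<sigma>" for \<sigma> \<tau>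
      using that unfolding K_def by blast
    show "continuous_map (function_space I ?Y) (geom_realization V K)
      (\<lambda>y. \<lambda>v\<in>V. W y v / sum (W y) V)"
    proof (rule continuous_map_normalize_to_geom_realization)
      have form: "continuous_map (function_space I ?Y) euclideanreal (lin_form I (a v))" for v
        using \<open>finite I\<close> by (rule continuous_map_lin_form)
      show "continuous_map (function_space I ?Y) euclideanreal (\<lambda>y. W y v)" if "v \<in> V" for v
      proof -
        have "V \<noteq> {}" using that by auto
        then have "continuous_map (function_space I ?Y) euclideanreal M"
          unfolding M_def using \<open>finite V\<close> form by (intro continuous_map_Max)
        then show ?thesis
          unfolding W_def using form
          by (intro continuous_map_real_max continuous_map_diff continuous_map_real_mult_left) auto
      qed
      fix y assume "y \<in> topspace (function_space I ?Y)"
      then have y: "y \<in> ?Y" by simp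
      show "\<exists>v\<in>V. 0 < W y v"
        using W_ex[OF y] W_M M_pos[OF y] by blast
      \<comment> \<open>Scaling the largest form to 1 turns the threshold
        \<open>(1 - \<epsilon>) * M y\<close> into the one in \<open>near\<close>.\<close>
      define z where "z = (\<lambda>i. inverse (M y) * y i)"
      have z: "lin_form I (a v) z = lin_form I (a v) y / M y" for v
        by (simp only: z_def lin_form_scale) (simp add: field_simps)
      have "{v \<in> V. 1 - \<epsilon> < lin_form I (a v) z} \<in> K"
        using M_pos[OF y] M_ge by (intro near) (simp add: z)
      moreover have "{v \<in> V. 1 - \<epsilon> < lin_form I (a v) z} = {v \<in> V. 0 < W y v}"
        using M_pos[OF y] by (auto simp: z W_def less_max_iff_disj pos_less_divide_eq)
      ultimately show "\<exists>\<sigma>\<in>K. {v \<in> V. 0 < W y v} \<subseteq> \<sigma>" by (metis order_refl)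
    qed (use \<open>finite V\<close> in \<open>auto simp: W_def\<close>)
    show "0 < (\<lambda>v\<in>V. W y v / sum (W y) V) v" if "v \<in> V" "y \<in> U v" for v y
    proof -
      have "M y \<le> lin_form I (a v) y"
        unfolding M_def using that \<open>finite V\<close> by (subst Max_le_iff) (auto simp: U_def)
      then have "0 < W y v"
        using M_ge[OF that(1), of y] that by (intro W_M) (auto simp: U_def)
      then show ?thesis using that sum_W by simp
    qed
    fix v y assume v: "v \<in> V" and y: "y \<in> ?Y"
      and max: "\<forall>w\<in>V. (\<lambda>v\<in>V. W y v / sum (W y) V) w \<le> (\<lambda>v\<in>V. W y v / sum (W y) V) v"
    from W_ex[OF y] obtain w where w: "w \<in> V" "lin_form I (a w) y = M y" by blast
    have Ww: "0 < W y w" using W_M[OF w(2) M_pos[OF y]] .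
    have "W y w \<le> W y v"
      using max w(1) v sum_W[OF w(1) Ww] by (auto simp: divide_le_cancel)
    \<comment> \<open>Where positive, the weight increases strictly with the form, so a maximal
      weight forces a maximal form.\<close>
    then have "M y \<le> lin_form I (a v) y"
      using Ww w(2) by (auto simp: W_def max_def split: if_splits)
    then show "y \<in> U v"
      using y M_pos[OF y] M_ge[of _ y] by (fastforce simp: U_def)
  qed (use \<open>finite V\<close> in \<open>auto simp: K_def\<close>)
qed

section \<open>Separation and positive convex representations\<close>

text \<open>Take \<open>y\<close> from \<open>r\<close> to the closest point of the hull and
  \<open>\<delta>\<close> as its squared length. That \<open>y\<close> lies in the span allows
  coordinates for it in the unbalanced complex; the margin \<open>\<delta>\<close> gives the
  quantitative gap for the dual.\<close>

lemma separate_from_finite: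
  fixes r :: "'a::euclidean_space"
  assumes "finite S" "r \<notin> convex hull S"
  obtains y \<delta> where "y \<in> span ((\<lambda>v. v - r) ` S)" "0 < \<delta>" "\<And>v. v \<in> S \<Longrightarrow> \<delta> \<le> y \<bullet> (v - r)"
proof (cases "S = {}")
  case True
  then show ?thesis using that[of 0 1] by simp
next
  case False
  let ?C = "convex hull S"
  have C: "closed ?C" "?C \<noteq> {}"
    using assms(1) False by (auto simp: finite_imp_compact_convex_hull compact_imp_closed)
  define y where "y = closest_point ?C r - r"
  have p: "closest_point ?C r \<in> ?C" using closest_point_in_set[OF C] .
  then have "y \<noteq> 0" using assms(2) by (auto simp: y_def)
  have "?C \<subseteq> {x. x - r \<in> span ((\<lambda>v. v - r) ` S)}"
  proof (rule hull_minimal)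
    show "S \<subseteq> {x. x - r \<in> span ((\<lambda>v. v - r) ` S)}"
      by (auto intro: span_base)
    have "{x. x - r \<in> span ((\<lambda>v. v - r) ` S)} = (+) r ` span ((\<lambda>v. v - r) ` S)"
      by (force simp: image_iff intro: add_diff_cancel_left')
    then show "convex {x. x - r \<in> span ((\<lambda>v. v - r) ` S)}"
      by (simp add: convex_translation subspace_imp_convex)
  qed
  then have y: "y \<in> span ((\<lambda>v. v - r) ` S)" using p by (auto simp: y_def)
  \<comment> \<open>The variational inequality at the closest point says that \<open>y\<close> has
    nonnegative inner product with \<open>v\<close> minus that point.\<close>
  have "y \<bullet> y \<le> y \<bullet> (v - r)" if "v \<in> S" for v
    using closest_point_dot[of ?C v r] C(1) hull_inc[OF that]
    by (simp add: y_def algebra_simps inner_commute)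
  then show ?thesis using that[OF y, of "y \<bullet> y"] \<open>y \<noteq> 0\<close> by simp
qed

text \<open>The segment from the barycentre \<open>b\<close> to \<open>r\<close> extends beyond
  \<open>r\<close> inside the hull, so \<open>r\<close> is a convex combination of a hull point and
  \<open>b\<close>, with positive weight on \<open>b\<close>.\<close>

lemma rel_interior_convex_hull_positive:
  fixes V :: "'a::euclidean_space set"
  assumes "finite V" "r \<in> rel_interior (convex hull V)"
  obtains c where "\<And>v. v \<in> V \<Longrightarrow> 0 < c v" "sum c V = 1" "(\<Sum>v\<in>V. c v *\<^sub>R v) = r"
proof -
  have "V \<noteq> {}" using assms(2) by auto
  then have card: "0 < real (card V)" using \<open>finite V\<close> by (simp add: card_gt_0_iff)
  define b where "b = (\<Sum>v\<in>V. (1 / real (card V)) *\<^sub>R v)"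
  have "b \<in> convex hull V"
    unfolding convex_hull_finite[OF \<open>finite V\<close>] b_def using card
    by (auto intro!: exI[of _ "\<lambda>_. 1 / real (card V)"])
  moreover have "\<forall>x\<in>convex hull V. \<exists>e>1. (1 - e) *\<^sub>R x + e *\<^sub>R r \<in> convex hull V"
    using assms(2) \<open>V \<noteq> {}\<close>
    by (subst (asm) convex_rel_interior_iff) auto
  ultimately obtain e where e: "1 < e" "(1 - e) *\<^sub>R b + e *\<^sub>R r \<in> convex hull V"
    by blast
  then obtain u where u: "\<And>v. v \<in> V \<Longrightarrow> 0 \<le> u v" "sum u V = 1"
    "(\<Sum>v\<in>V. u v *\<^sub>R v) = (1 - e) *\<^sub>R b + e *\<^sub>R r"
    unfolding convex_hull_finite[OF \<open>finite V\<close>] by auto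
  \<comment> \<open>Obtained by solving the equation for \<open>u\<close> for
    \<open>r\<close>.\<close>
  define c where "c v = (u v + (e - 1) / real (card V)) / e" for v
  show thesis
  proof (rule that)
    show "0 < c v" if "v \<in> V" for v
      using u(1)[OF that] e card by (auto simp: c_def intro!: divide_pos_pos add_nonneg_pos)
    show "sum c V = 1"
      using u(2) e card by (simp add: c_def sum.distrib flip: sum_divide_distrib)
    have "e *\<^sub>R (\<Sum>v\<in>V. c v *\<^sub>R v) = (\<Sum>v\<in>V. u v *\<^sub>R v + (e - 1) *\<^sub>R (1 / real (card V)) *\<^sub>R v)"
      unfolding scaleR_sum_right using e
      by (intro sum.cong) (auto simp: c_def scaleR_add_left)
    also have "\<dots> = (\<Sum>v\<in>V. u v *\<^sub>R v) + (e - 1) *\<^sub>R b"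
      by (simp add: sum.distrib b_def scaleR_sum_right)
    also have "\<dots> = e *\<^sub>R r"
      by (simp add: u(3) algebra_simps)
    finally show "(\<Sum>v\<in>V. c v *\<^sub>R v) = r" using e by simp
  qed
qed

section \<open>The unbalanced complex\<close>

theorem unbalanced_complex_homotopy:
  fixes V :: "'a::euclidean_space set" and r :: 'a
  assumes "finite V" and r: "r \<in> rel_interior (convex hull V)"
  shows "geom_realization V (unbalanced_complex V r)
    homotopy_equivalent_space int_sphere (aff_dim V - 1)"
proof -
  define L where "L = span ((\<lambda>v. v - r) ` V)"
  obtain I where "I \<subseteq> L" and ind: "independent I" and "L \<subseteq> span I" and card: "card I = dim L"
    using basis_exists[of L] by blast
  then have span: "span I = L"
    unfolding L_def by (simp add: span_minimal subset_antisym)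
  have "finite I" using ind by (rule independent_imp_finite)
  \<comment> \<open>This makes the dimension of \<open>L\<close> equal to
    \<open>aff_dim V\<close>.\<close>
  have hull: "r \<in> affine hull V"
    using r rel_interior_subset convex_hull_subset_affine_hull by blast
  have card_I: "int (card I) = aff_dim V"
    unfolding card L_def dim_span aff_dim_eq_dim_subtract[OF hull] ..
  define a where "a v e = e \<bullet> (v - r)" for v e
  have form: "lin_form I (a v) y = (\<Sum>e\<in>I. y e *\<^sub>R e) \<bullet> (v - r)" for v y
    by (simp add: lin_form_def a_def inner_sum_left mult.commute)
  obtain c where c: "\<And>v. v \<in> V \<Longrightarrow> 0 < c v" "sum c V = 1" "(\<Sum>v\<in>V. c v *\<^sub>R v) = r"
    using rel_interior_convex_hull_positive[OF \<open>finite V\<close> r] by blast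
  have pos: "\<exists>v\<in>V. 0 < lin_form I (a v) y" if y: "y \<in> nonzero_functions I" for y
  proof (rule ccontr)
    assume "\<not> ?thesis"
    then have le: "\<And>v. v \<in> V \<Longrightarrow> lin_form I (a v) y \<le> 0" by force
    define z where "z = (\<Sum>e\<in>I. y e *\<^sub>R e)"
    \<comment> \<open>The positive weights \<open>c\<close> balance the vectors
      \<open>v - r\<close>. If no form is positive, all of them vanish, and \<open>z\<close> is
      orthogonal to the space \<open>L\<close> that contains it.\<close>
    have "(\<Sum>v\<in>V. c v * (z \<bullet> (v - r))) = z \<bullet> (\<Sum>v\<in>V. c v *\<^sub>R (v - r))"
      by (simp add: inner_sum_right)
    also have "(\<Sum>v\<in>V. c v *\<^sub>R (v - r)) = 0"
      by (simp add: scaleR_diff_right sum_subtractf c flip: scaleR_sum_left)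
    finally have "(\<Sum>v\<in>V. c v * (z \<bullet> (v - r))) = 0" by simp
    then have "(\<Sum>v\<in>V. - (c v * (z \<bullet> (v - r)))) = 0" by (simp add: sum_negf)
    then have "\<forall>v\<in>V. - (c v * (z \<bullet> (v - r))) = 0"
      using \<open>finite V\<close> le c(1)
      by (subst (asm) sum_nonneg_eq_0_iff) (auto simp: form z_def mult_nonneg_nonpos less_imp_le)
    then have "\<forall>v\<in>V. orthogonal z (v - r)"
      using c(1) by (force simp: orthogonal_def)
    then have "orthogonal z x" if "x \<in> L" for x
      using orthogonal_to_span[of x "(\<lambda>v. v - r) ` V" z] that by (auto simp: L_def)
    moreover have "z \<in> L"
      unfolding z_def span[symmetric] by (intro span_sum span_mul span_base)
    ultimately have "z = 0" using orthogonal_self by blast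
    then have "\<forall>e\<in>I. y e = 0"
      using ind \<open>finite I\<close> unfolding z_def independent_explicit by blast
    then show False using y by auto
  qed
  have "unbalanced_complex V r = {S. S \<subseteq> V \<and> (\<exists>y. \<forall>v\<in>S. 0 < lin_form I (a v) y)}"
  proof -
    have "\<exists>y. \<forall>v\<in>S. 0 < lin_form I (a v) y" if S: "S \<subseteq> V" "r \<notin> convex hull S" for S
    proof -
      obtain z \<delta> where z: "z \<in> span ((\<lambda>v. v - r) ` S)" "0 < \<delta>" "\<And>v. v \<in> S \<Longrightarrow> \<delta> \<le> z \<bullet> (v - r)"
        using separate_from_finite[OF _ S(2)] S(1) \<open>finite V\<close> by (metis finite_subset)
      have "z \<in> span I"
        using z(1) S(1) span_mono[of "(\<lambda>v. v - r) ` S" "(\<lambda>v. v - r) ` V"]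
        by (auto simp: span L_def)
      then obtain y where "z = (\<Sum>e\<in>I. y e *\<^sub>R e)"
        using \<open>finite I\<close> by (auto simp: span_finite)
      then have "\<forall>v\<in>S. 0 < lin_form I (a v) y"
        using z(2,3) by (force simp: form)
      then show ?thesis by blast
    qed
    moreover have False if S: "\<forall>v\<in>S. 0 < lin_form I (a v) y" "r \<in> convex hull S" for S y
    proof -
      define z where "z = (\<Sum>e\<in>I. y e *\<^sub>R e)"
      have "convex hull S \<subseteq> {x. z \<bullet> r < z \<bullet> x}"
        using S(1) by (intro hull_minimal convex_halfspace_gt) (auto simp: form z_def inner_diff_right)
      then show False using S(2) by auto
    qed
    ultimately show ?thesis unfolding unbalanced_complex_def by blast
  qed
  then have "function_space I (nonzero_functions I) homotopy_equivalent_space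
      geom_realization V (unbalanced_complex V r)"
    using open_halfspace_nerve[OF \<open>finite V\<close> \<open>finite I\<close>, of a] pos by simp
  then show ?thesis
    using nonzero_functions_homotopy_equivalent_sphere[OF \<open>finite I\<close>] unfolding card_I
    by (meson homotopy_equivalent_space_sym homotopy_eqv_trans)
qed

section \<open>The Alexander dual\<close>

text \<open>Affine dependences are parametrized by their values on \<open>I\<close>, the complement
  of an affine basis \<open>B\<close>; this is why \<open>card I\<close> is the dimension of their
  space.\<close>

theorem alexander_dual_homotopy:
  fixes V :: "'a::euclidean_space set" and r :: 'a
  assumes "finite V" and r: "r \<in> rel_interior (convex hull V)"
  shows "geom_realization V (alexander_dual V (unbalanced_complex V r))
    homotopy_equivalent_space int_sphere (int (card V) - aff_dim V - 2)"
proof -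
  obtain B where "B \<subseteq> V" and indep: "\<not> affine_dependent B" and hull: "affine hull V = affine hull B"
    using affine_basis_exists by blast
  have finB: "finite B" using \<open>finite V\<close> \<open>B \<subseteq> V\<close> by (rule finite_subset[rotated])
  define I where "I = V - B"
  have "finite I" using \<open>finite V\<close> by (simp add: I_def)
  have "int (card B) = aff_dim V + 1"
    using aff_dim_unique[of B V] hull indep by simp
  then have card_I: "int (card I) - 1 = int (card V) - aff_dim V - 2"
    using \<open>B \<subseteq> V\<close> \<open>finite V\<close> by (simp add: I_def card_Diff_subset finB card_mono of_nat_diff)
  have "\<exists>d. sum d B = 1 \<and> (\<Sum>b\<in>B. d b *\<^sub>R b) = i" if "i \<in> V" for i
    using hull_inc[OF that, of affine] unfolding hull affine_hull_finite[OF finB] by auto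
  then obtain d where d: "\<And>i. i \<in> V \<Longrightarrow> sum (d i) B = 1" "\<And>i. i \<in> V \<Longrightarrow> (\<Sum>b\<in>B. d i b *\<^sub>R b) = i"
    by metis
  obtain c where c: "\<And>v. v \<in> V \<Longrightarrow> 0 < c v" "sum c V = 1" "(\<Sum>v\<in>V. c v *\<^sub>R v) = r"
    using rel_interior_convex_hull_positive[OF \<open>finite V\<close> r] by blast
  \<comment> \<open>Each \<open>i \<in> I\<close> gives the dependence with value 1 at
    \<open>i\<close> and minus the affine coordinates \<open>d i\<close> on \<open>B\<close>;
    \<open>\<mu> y\<close> combines these with coefficients \<open>y\<close>. The vectors
    \<open>a v\<close> are chosen to make \<open>form\<close> hold.\<close>
  define \<mu> where "\<mu> y v = (if v \<in> I then y v else - (\<Sum>i\<in>I. y i * d i v))" for y :: "'a \<Rightarrow> real" and v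
  define a where "a v i = (if v \<in> I then (if i = v then 1 else 0) else - d i v) / c v" for v i
  have form: "lin_form I (a v) y = \<mu> y v / c v" for v y
  proof (cases "v \<in> I")
    case True
    have "lin_form I (a v) y = (\<Sum>i\<in>I. if i = v then y v / c v else 0)"
      unfolding lin_form_def by (intro sum.cong) (auto simp: a_def True)
    then show ?thesis using True \<open>finite I\<close> by (simp add: \<mu>_def)
  next
    case False
    then show ?thesis
      by (simp add: lin_form_def a_def \<mu>_def sum_divide_distrib sum_negf mult.commute)
  qed
  have mu_B: "\<mu> y b = - (\<Sum>i\<in>I. y i * d i b)" if "b \<in> B" for y b
    using that by (simp add: \<mu>_def I_def)
  have mu_I: "\<mu> y i = y i" if "i \<in> I" for y i
    using that by (simp add: \<mu>_def)
  have split: "sum h V = sum h I + sum h B" for h :: "'a \<Rightarrow> 'c::comm_monoid_add"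
    unfolding I_def using sum.subset_diff[OF \<open>B \<subseteq> V\<close> \<open>finite V\<close>] .
  have IV: "i \<in> V" if "i \<in> I" for i using that by (simp add: I_def)
  have mu_sum: "sum (\<mu> y) V = 0" for y
  proof -
    have "sum (\<mu> y) B = - (\<Sum>i\<in>I. y i * sum (d i) B)"
      unfolding sum_distrib_left by (subst sum.swap) (simp add: mu_B sum_negf)
    then show ?thesis unfolding split by (simp add: mu_I d IV)
  qed
  have mu_lin: "(\<Sum>v\<in>V. \<mu> y v *\<^sub>R v) = 0" for y
  proof -
    have "(\<Sum>b\<in>B. \<mu> y b *\<^sub>R b) = - (\<Sum>i\<in>I. y i *\<^sub>R (\<Sum>b\<in>B. d i b *\<^sub>R b))"
      unfolding scaleR_sum_right by (subst sum.swap) (simp add: mu_B sum_negf scaleR_sum_left)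
    then show ?thesis unfolding split by (simp add: mu_I d IV)
  qed
  \<comment> \<open>An affine dependence is determined by its values off the affine basis \<open>B\<close>.\<close>
  have rep: "\<mu> m v = m v" if m: "sum m V = 0" "(\<Sum>v\<in>V. m v *\<^sub>R v) = 0" and "v \<in> V" for m v
  proof (cases "v \<in> B")
    case True
    define n where "n v = \<mu> m v - m v" for v
    have "sum n V = 0" "(\<Sum>v\<in>V. n v *\<^sub>R v) = 0"
      by (simp_all add: n_def sum_subtractf scaleR_diff_left mu_sum mu_lin m)
    then have "sum n B = 0" "(\<Sum>v\<in>B. n v *\<^sub>R v) = 0"
      unfolding split by (simp_all add: n_def mu_I)
    then have "n v = 0"
      using indep True unfolding affine_dependent_explicit_finite[OF finB] by blast
    then show ?thesis by (simp add: n_def)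
  next
    case False
    then show ?thesis using \<open>v \<in> V\<close> by (simp add: mu_I I_def)
  qed
  have pos: "\<exists>v\<in>V. 0 < lin_form I (a v) y" if y: "y \<in> nonzero_functions I" for y
  proof (rule ccontr)
    assume "\<not> ?thesis"
    \<comment> \<open>A dependence sums to zero, so it cannot be nonpositive everywhere unless it
      vanishes.\<close>
    then have "\<forall>v\<in>V. lin_form I (a v) y \<le> 0" by force
    then have "\<forall>v\<in>V. 0 \<le> - \<mu> y v" using c(1) by (fastforce simp: form divide_le_0_iff)
    moreover have "(\<Sum>v\<in>V. - \<mu> y v) = 0" by (simp add: sum_negf mu_sum)
    ultimately have "\<forall>v\<in>V. - \<mu> y v = 0"
      using \<open>finite V\<close> by (subst (asm) sum_nonneg_eq_0_iff) auto
    then show False using y mu_I IV by force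
  qed
  \<comment> \<open>The coefficients reached from \<open>c\<close> by subtracting
    \<open>\<mu> y\<close>. They represent \<open>r\<close> affinely, are nonnegative exactly when
    all forms are at most 1, and vanish at \<open>v\<close> exactly when the form there is
    1.\<close>
  define \<Lambda> where "\<Lambda> y v = c v * (1 - lin_form I (a v) y)" for y v
  have Lam: "\<Lambda> y v = c v - \<mu> y v" if "v \<in> V" for y v
    using c(1)[OF that] by (simp add: \<Lambda>_def form field_simps)
  have Lam_sum: "sum (\<Lambda> y) V = 1" for y
    by (simp add: Lam sum_subtractf mu_sum c)
  have Lam_lin: "(\<Sum>v\<in>V. \<Lambda> y v *\<^sub>R v) = r" for y
    by (simp add: Lam scaleR_diff_left sum_subtractf mu_lin c)
  let ?K = "{\<sigma>. \<sigma> \<subseteq> V \<and> (\<exists>y. \<forall>v\<in>\<sigma>. 0 < lin_form I (a v) y \<and>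
      (\<forall>w\<in>V. lin_form I (a w) y \<le> lin_form I (a v) y))}"
  have in_K: "\<sigma> \<in> ?K" if \<sigma>: "\<sigma> \<subseteq> V" "r \<in> convex hull (V - \<sigma>)" for \<sigma>
  proof -
    have "finite (V - \<sigma>)" using \<open>finite V\<close> by simp
    then obtain u where u: "\<forall>v\<in>V - \<sigma>. 0 \<le> u v" "sum u (V - \<sigma>) = 1" "(\<Sum>v\<in>V - \<sigma>. u v *\<^sub>R v) = r"
      using \<sigma>(2) unfolding convex_hull_finite[OF \<open>finite (V - \<sigma>)\<close>] by blast
    \<comment> \<open>A convex representation of \<open>r\<close> vanishing on
      \<open>\<sigma>\<close>. Its difference from \<open>c\<close> is a dependence, whose form is 1
      on \<open>\<sigma>\<close> and at most 1 elsewhere.\<close>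
    define l where "l v = (if v \<in> \<sigma> then 0 else u v)" for v
    have l: "sum l V = 1" "(\<Sum>v\<in>V. l v *\<^sub>R v) = r"
    proof -
      have "sum l V = sum u (V - \<sigma>)"
        using \<open>finite V\<close> by (intro sum.mono_neutral_cong_right) (auto simp: l_def)
      then show "sum l V = 1" using u by simp
      have "(\<Sum>v\<in>V. l v *\<^sub>R v) = (\<Sum>v\<in>V - \<sigma>. u v *\<^sub>R v)"
        using \<open>finite V\<close> by (intro sum.mono_neutral_cong_right) (auto simp: l_def)
      then show "(\<Sum>v\<in>V. l v *\<^sub>R v) = r" using u by simp
    qed
    define m where "m v = c v - l v" for v
    have "sum m V = 0" "(\<Sum>v\<in>V. m v *\<^sub>R v) = 0"
      by (simp_all add: m_def sum_subtractf scaleR_diff_left c l)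
    note mu = rep[OF this]
    have "lin_form I (a v) m = 1 - l v / c v" if "v \<in> V" for v
      using c(1)[OF that] by (simp add: form mu[OF that] m_def field_simps)
    moreover have "0 \<le> l v / c v" if "v \<in> V" for v
      using u(1) c(1)[OF that] that by (auto simp: l_def)
    ultimately have "\<forall>v\<in>\<sigma>. lin_form I (a v) m = 1" "\<forall>w\<in>V. lin_form I (a w) m \<le> 1"
      using \<sigma>(1) by (auto simp: l_def)
    then show ?thesis using \<sigma>(1) by (force intro!: exI[of _ m])
  qed
  have K_in: "r \<in> convex hull (V - \<sigma>)" if "\<sigma> \<in> ?K" for \<sigma>
  proof (cases "\<sigma> = {}")
    case True
    then show ?thesis using r rel_interior_subset by auto
  next
    case False
    have "\<sigma> \<subseteq> V" using that by blast
    from that obtain y where y: "\<forall>v\<in>\<sigma>. 0 < lin_form I (a v) y \<and>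
        (\<forall>w\<in>V. lin_form I (a w) y \<le> lin_form I (a v) y)"
      by (elim CollectE conjE exE)
    from False obtain v where v: "v \<in> \<sigma>" by blast
    define M where "M = lin_form I (a v) y"
    have M: "0 < M" "\<And>w. w \<in> V \<Longrightarrow> lin_form I (a w) y \<le> M"
      "\<And>w. w \<in> \<sigma> \<Longrightarrow> lin_form I (a w) y = M"
      using y v \<open>\<sigma> \<subseteq> V\<close> by (auto simp: M_def intro!: antisym)
    \<comment> \<open>Scaling the common maximum to 1 makes \<open>\<Lambda> z\<close> nonnegative
      and zero on \<open>\<sigma>\<close>, a convex representation of \<open>r\<close> by
      \<open>V - \<sigma>\<close>. Nonemptiness of \<open>\<sigma>\<close> provides the value
      \<open>M > 0\<close>.\<close>
    define z where "z = (\<lambda>i. inverse M * y i)"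
    have z: "lin_form I (a w) z = lin_form I (a w) y / M" for w
      by (simp only: z_def lin_form_scale) (simp add: field_simps)
    have Lz: "\<Lambda> z w = 0" if "w \<in> \<sigma>" for w
      using M that by (simp add: \<Lambda>_def z)
    have "0 \<le> \<Lambda> z w" if "w \<in> V" for w
      using M(1) M(2)[OF that] c(1)[OF that] by (simp add: \<Lambda>_def z)
    moreover have "sum (\<Lambda> z) (V - \<sigma>) = 1"
      unfolding Lam_sum[of z, symmetric]
      using Lz \<open>\<sigma> \<subseteq> V\<close> \<open>finite V\<close> by (intro sum.mono_neutral_left) auto
    moreover have "(\<Sum>w\<in>V - \<sigma>. \<Lambda> z w *\<^sub>R w) = r"
      unfolding Lam_lin[of z, symmetric]
      using Lz \<open>\<sigma> \<subseteq> V\<close> \<open>finite V\<close> by (intro sum.mono_neutral_left) auto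
    moreover have "finite (V - \<sigma>)" using \<open>finite V\<close> by simp
    ultimately show ?thesis
      unfolding convex_hull_finite[OF \<open>finite (V - \<sigma>)\<close>] by blast
  qed
  have K: "alexander_dual V (unbalanced_complex V r) = ?K"
  proof (intro subset_antisym subsetI)
    fix \<sigma> assume "\<sigma> \<in> alexander_dual V (unbalanced_complex V r)"
    then have "\<sigma> \<subseteq> V" "r \<in> convex hull (V - \<sigma>)"
      by (auto simp: alexander_dual_def unbalanced_complex_def)
    then show "\<sigma> \<in> ?K" by (rule in_K)
  next
    fix \<sigma> assume \<sigma>: "\<sigma> \<in> ?K"
    then have "\<sigma> \<subseteq> V" by (elim CollectE conjE)
    then show "\<sigma> \<in> alexander_dual V (unbalanced_complex V r)"
      using K_in[OF \<sigma>] by (simp add: alexander_dual_def unbalanced_complex_def)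
  qed
  let ?F = "{\<sigma>. \<sigma> \<subseteq> V \<and> r \<notin> convex hull (V - \<sigma>)}"
  \<comment> \<open>A nonface stays quantitatively away from being a common set of facets: the hyperplane
    separating \<open>r\<close> from \<open>V - \<sigma>\<close> bounds the weight of any representation of \<open>r\<close> on \<open>\<sigma>\<close> below.\<close>
  have gap: "\<exists>e>0. \<forall>y. (\<forall>w\<in>V. lin_form I (a w) y \<le> 1) \<longrightarrow> \<not> (\<forall>v\<in>\<sigma>. 1 - e < lin_form I (a v) y)"
    if \<sigma>: "\<sigma> \<in> ?F" for \<sigma>
  proof -
    have fin: "finite (V - \<sigma>)" and out: "r \<notin> convex hull (V - \<sigma>)"
      using \<open>finite V\<close> \<sigma> by simp_all
    obtain z \<delta> where \<delta>: "0 < \<delta>" "\<And>v. v \<in> V - \<sigma> \<Longrightarrow> \<delta> \<le> z \<bullet> (v - r)"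
      using separate_from_finite[OF fin out] by metis
    \<comment> \<open>Summing \<open>bound\<close> below over \<open>V\<close> gives
      \<open>\<delta> - e * (\<delta> + C) \<le> 0\<close>, since both \<open>c\<close> and
      \<open>\<Lambda> y\<close> sum to 1; \<open>e\<close> is chosen to contradict this.\<close>
    define C where "C = (\<Sum>v\<in>V. c v * \<bar>z \<bullet> (v - r)\<bar>)"
    have "0 \<le> C" unfolding C_def using c(1) by (intro sum_nonneg) (simp add: less_imp_le)
    define e where "e = \<delta> / (\<delta> + C + 1)"
    have "0 < e" using \<delta>(1) \<open>0 \<le> C\<close> by (simp add: e_def)
    have e: "e * (\<delta> + C) < \<delta>"
      using \<delta>(1) \<open>0 \<le> C\<close> by (simp add: e_def field_simps)
    have False if y: "\<forall>w\<in>V. lin_form I (a w) y \<le> 1" "\<forall>v\<in>\<sigma>. 1 - e < lin_form I (a v) y" for y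
    proof -
      \<comment> \<open>On \<open>\<sigma>\<close> the coefficient \<open>\<Lambda> y v\<close> is
        at most \<open>c v * e\<close>, so the error is small; off \<open>\<sigma>\<close> the
        separation gives the margin \<open>\<delta>\<close>.\<close>
      have bound: "\<delta> * \<Lambda> y v - e * (c v * (\<delta> + \<bar>z \<bullet> (v - r)\<bar>)) \<le> \<Lambda> y v * (z \<bullet> (v - r))"
        if v: "v \<in> V" for v
      proof -
        have L0: "0 \<le> \<Lambda> y v" using y(1) v c(1)[OF v] by (simp add: \<Lambda>_def)
        show ?thesis
        proof (cases "v \<in> \<sigma>")
          case True
          have "\<Lambda> y v \<le> c v * e"
            unfolding \<Lambda>_def using y(2) True c(1)[OF v] by (intro mult_left_mono) force+
          then have "\<Lambda> y v * (\<delta> - z \<bullet> (v - r)) \<le> (c v * e) * (\<delta> + \<bar>z \<bullet> (v - r)\<bar>)"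
            using L0 \<delta>(1) by (intro order_trans[OF mult_left_mono mult_right_mono]) auto
          then show ?thesis by (simp add: algebra_simps)
        next
          case False
          then have "\<Lambda> y v * \<delta> \<le> \<Lambda> y v * (z \<bullet> (v - r))"
            using \<delta>(2) v L0 by (intro mult_left_mono) auto
          moreover have "0 \<le> e * (c v * (\<delta> + \<bar>z \<bullet> (v - r)\<bar>))"
            using \<open>0 < e\<close> c(1)[OF v] \<delta>(1) by simp
          ultimately show ?thesis by (simp add: mult.commute)
        qed
      qed
      have "\<delta> - e * (\<delta> + C) = (\<Sum>v\<in>V. \<delta> * \<Lambda> y v - e * (c v * (\<delta> + \<bar>z \<bullet> (v - r)\<bar>)))"
        by (simp add: sum_subtractf C_def Lam_sum distrib_left sum.distrib c
            flip: sum_distrib_left sum_distrib_right)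
      also have "\<dots> \<le> (\<Sum>v\<in>V. \<Lambda> y v * (z \<bullet> (v - r)))"
        using bound by (rule sum_mono)
      also have "\<dots> = z \<bullet> (\<Sum>v\<in>V. \<Lambda> y v *\<^sub>R (v - r))"
        by (simp add: inner_sum_right)
      also have "(\<Sum>v\<in>V. \<Lambda> y v *\<^sub>R (v - r)) = 0"
        by (simp add: scaleR_diff_right sum_subtractf Lam_lin Lam_sum flip: scaleR_sum_left)
      finally show False using e by simp
    qed
    then show ?thesis using \<open>0 < e\<close> by blast
  qed
  then have "\<forall>\<sigma>\<in>?F. \<exists>e. 0 < e \<and> (\<forall>y. (\<forall>w\<in>V. lin_form I (a w) y \<le> 1) \<longrightarrow>
      \<not> (\<forall>v\<in>\<sigma>. 1 - e < lin_form I (a v) y))"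
    by (intro ballI) assumption
  from bchoice[OF this] obtain e where e: "\<forall>\<sigma>\<in>?F. 0 < e \<sigma> \<and> (\<forall>y. (\<forall>w\<in>V. lin_form I (a w) y \<le> 1) \<longrightarrow>
      \<not> (\<forall>v\<in>\<sigma>. 1 - e \<sigma> < lin_form I (a v) y))"
    by (elim exE)
  have "finite ?F" using \<open>finite V\<close> by simp
  \<comment> \<open>One gap for all of the finitely many nonfaces; inserting 1 makes the minimum
    well defined without a separate nonemptiness argument.\<close>
  define \<epsilon> where "\<epsilon> = Min (insert 1 (e ` ?F))"
  have "0 < \<epsilon>" unfolding \<epsilon>_def using \<open>finite ?F\<close> e by (subst Min_gr_iff) auto
  have near: "{v \<in> V. 1 - \<epsilon> < lin_form I (a v) y} \<in> ?K"
    if y: "\<forall>w\<in>V. lin_form I (a w) y \<le> 1" for y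
  proof (rule in_K)
    let ?\<sigma> = "{v \<in> V. 1 - \<epsilon> < lin_form I (a v) y}"
    show "r \<in> convex hull (V - ?\<sigma>)"
    proof (rule ccontr)
      assume "r \<notin> convex hull (V - ?\<sigma>)"
      then have F: "?\<sigma> \<in> ?F" by simp
      then have "\<epsilon> \<le> e ?\<sigma>"
        unfolding \<epsilon>_def using \<open>finite ?F\<close> by (intro Min_le finite_insert[THEN iffD2] finite_imageI insertI2 imageI)
      then show False using bspec[OF e F] y by force
    qed
  qed simp
  have "function_space I (nonzero_functions I) homotopy_equivalent_space
      geom_realization V (alexander_dual V (unbalanced_complex V r))"
    unfolding K using \<open>finite V\<close> \<open>finite I\<close> pos \<open>0 < \<epsilon>\<close> near by (rule facet_nerve)
  then show ?thesis
    using nonzero_functions_homotopy_equivalent_sphere[OF \<open>finite I\<close>] unfolding card_I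
    by (meson homotopy_equivalent_space_sym homotopy_eqv_trans)
qed

theorem theorem3:
  fixes V :: "'a::euclidean_space set" and r :: 'a
  assumes "finite V"
    and "r \<in> rel_interior (convex hull V)"
  shows "geom_realization V (unbalanced_complex V r)
           homotopy_equivalent_space int_sphere (aff_dim V - 1)
       \<and> geom_realization V (alexander_dual V (unbalanced_complex V r))
           homotopy_equivalent_space int_sphere (int (card V) - aff_dim V - 2)"
  using unbalanced_complex_homotopy[OF assms] alexander_dual_homotopy[OF assms] ..

end
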